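(* Let $(X,qp_{bl})$ be a 0-complete quasi-partial b-metric-like space with coefficient $s\ge 1$ and let $T:X\to X$ be a map satisfying $$\phi(qp_{bl}(Tx,Ty))\le \frac{\phi(qp_{bl}(x,y))}{s}-\psi(qp_{bl}(x,y))\quad\text{for all } x,y\in X,$$ where $\phi,\psi:[0,\infty)\to[0,\infty)$ are continuous, monotone non-decreasing functions with $\phi(t)=0=\psi(t)$ if and only if $t=0$. Suppose also that $\phi$ is linear and $\phi(\psi(t))\le\psi(t)$ for $t>0$. Then $T$ has a unique fixed point.
   Context: A quasi-partial b-metric-like on a non-empty set $X$ is a function $qp_{bl}:X\times X\to[0,\infty)$ such that for some real number $s\ge 1$ and all $x,y,z\in X$: (1) if $qp_{bl}(x,y)=0$ then $x=y$; (2) $qp_{bl}(x,x)\le qp_{bl}(x,y)$; (3) $qp_{bl}(x,x)\le qp_{bl}(y,x)$; (4) $qp_{bl}(x,y)\le s[qp_{bl}(x,z)+qp_{bl}(z,y)]-qp_{bl}(z,z)$. The pair $(X,qp_{bl})$ is called a quasi-partial b-metric-like space and $s$ its coefficient. A sequence $\{x_n\}\subseteq X$ is 0-Cauchy if $\lim_{n,m\to\infty}qp_{bl}(x_n,x_m)=0=\lim_{n,m\to\infty}qp_{bl}(x_m,x_n)$. The space $(X,qp_{bl})$ is 0-complete if for every 0-Cauchy sequence $\{x_n\}\subseteq X$ there exists $x\in X$ such that $\lim_{n\to\infty}qp_{bl}(x_n,x)=\lim_{n\to\infty}qp_{bl}(x,x_n)=qp_{bl}(x,x)=0=\lim_{n,m\to\infty}qp_{bl}(x_n,x_m)=\lim_{n,m\to\infty}qp_{bl}(x_m,x_n)$.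 The condition "$\phi(t)=0=\psi(t)$ if and only if $t=0$" means that each of $\phi$ and $\psi$ vanishes exactly at $0$. Linearity of $\phi$ on $[0,\infty)$ means $\phi(a+b)=\phi(a)+\phi(b)$ and $\phi(ca)=c\,\phi(a)$ for all $a,b,c\ge 0$. *)

theory Defs
  imports "HOL-Analysis.Analysis"
begin

text \<open>
  The underlying set is an explicit carrier \<open>X\<close>; nothing is assumed about \<open>q\<close> outside
  \<open>X \<times> X\<close>. The coefficient \<open>s\<close> is a parameter.
\<close>

definition quasi_partial_b_metric_like ::
    "'a set \<Rightarrow> ('a \<Rightarrow> 'a \<Rightarrow> real) \<Rightarrow> real \<Rightarrow> bool" where
  "quasi_partial_b_metric_like X q s \<longleftrightarrow>
     X \<noteq> {} \<and> s \<ge> 1 \<and>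
     (\<forall>x\<in>X. \<forall>y\<in>X. 0 \<le> q x y) \<and>
     (\<forall>x\<in>X. \<forall>y\<in>X. q x y = 0 \<longrightarrow> x = y) \<and>
     (\<forall>x\<in>X. \<forall>y\<in>X. q x x \<le> q x y) \<and>
     (\<forall>x\<in>X. \<forall>y\<in>X. q x x \<le> q y x) \<and>
     (\<forall>x\<in>X. \<forall>y\<in>X. \<forall>z\<in>X. q x y \<le> s * (q x z + q z y) - q z z)"

text \<open>
  Double limits as \<open>n, m \<rightarrow> \<infinity>\<close> are joint limits, i.e. limits along the product filter.
\<close>

definition zero_Cauchy :: "('a \<Rightarrow> 'a \<Rightarrow> real) \<Rightarrow> (nat \<Rightarrow> 'a) \<Rightarrow> bool" where
  "zero_Cauchy q x \<longleftrightarrow>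
     ((\<lambda>(n, m). q (x n) (x m)) \<longlongrightarrow> 0) (sequentially \<times>\<^sub>F sequentially) \<and>
     ((\<lambda>(n, m). q (x m) (x n)) \<longlongrightarrow> 0) (sequentially \<times>\<^sub>F sequentially)"

definition zero_complete :: "'a set \<Rightarrow> ('a \<Rightarrow> 'a \<Rightarrow> real) \<Rightarrow> bool" where
  "zero_complete X q \<longleftrightarrow>
     (\<forall>x. range x \<subseteq> X \<and> zero_Cauchy q x \<longrightarrow>
       (\<exists>l\<in>X.
          (\<lambda>n. q (x n) l) \<longlonglongrightarrow> q l l \<and>
          (\<lambda>n. q l (x n)) \<longlonglongrightarrow> q l l \<and>
          q l l = 0 \<and>
          ((\<lambda>(n, m). q (x n) (x m)) \<longlongrightarrow> 0) (sequentially \<times>\<^sub>F sequentially) \<and>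
          ((\<lambda>(n, m). q (x m) (x n)) \<longlongrightarrow> 0) (sequentially \<times>\<^sub>F sequentially)))"

definition linear_on_nonneg :: "(real \<Rightarrow> real) \<Rightarrow> bool" where
  "linear_on_nonneg f \<longleftrightarrow>
     (\<forall>a\<ge>0. \<forall>b\<ge>0. f (a + b) = f a + f b) \<and>
     (\<forall>c\<ge>0. \<forall>a\<ge>0. f (c * a) = c * f a)"

end

theory Submission
  imports Defs
begin

text \<open>
  A linear \<open>\<phi>\<close> on \<open>[0,\<infinity>)\<close> is \<open>t \<mapsto> \<phi> 1 * t\<close> with \<open>\<phi> 1 > 0\<close>, so dividing the hypothesis on
  \<open>T\<close> by \<open>\<phi> 1 / s\<close> turns it into \<open>s * q (T x) (T y) \<le> q x y - \<eta> (q x y)\<close>, where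
  \<open>\<eta> t = s * \<psi> t / \<phi> 1\<close> is monotone and positive away from \<open>0\<close>. The factor \<open>s\<close> on the left
  is exactly what the relaxed triangle inequality loses, and this lets a Meir-Keeler argument run
  as in a metric space.

  Along an orbit \<open>x\<^sub>n = T\<^sup>n x\<^sub>0\<close> each step loses at least \<open>\<eta>\<close> of itself, so the steps tend to
  \<open>0\<close> (\<open>tendsto_zero_if_decrement\<close>). Passing from \<open>x = x\<^sub>N\<close> to \<open>T y\<close> through \<open>T x\<close> gives
  \<open>q x (T y) \<le> s * q x (T x) + s * q (T x) (T y) \<le> s * q x (T x) + q x y - \<eta> (q x y)\<close>,
  so once the step at \<open>N\<close> is small compared with \<open>\<epsilon>\<close> and \<open>\<eta> (\<epsilon> / 2)\<close>, the orbit cannot leave the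
  \<open>\<epsilon>\<close>-ball around \<open>x\<^sub>N\<close> (\<open>ball_invariant\<close>, \<open>orbit_stays_close\<close>). The axioms and the contraction
  condition survive exchanging the arguments of \<open>q\<close>, so the estimate holds in both directions and
  the orbit is 0-Cauchy. Its limit is a fixed point, and two fixed points are at distance \<open>0\<close>
  because \<open>T\<close> would otherwise strictly decrease the distance between them.
\<close>

section \<open>Linear functions and decreasing sequences\<close>

lemma linear_on_nonneg_eq_scale:
  assumes "linear_on_nonneg f" "t \<ge> 0"
  shows "f t = f 1 * t"
proof -
  have "f (t * 1) = t * f 1"
    using assms unfolding linear_on_nonneg_def by (meson zero_le_one)
  then show ?thesis
    by (simp add: mult.commute)
qed

text \<open>
  As long as the sequence stays above a level \<open>\<epsilon> > 0\<close>, each step lowers it by at least the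
  fixed amount \<open>\<eta> \<epsilon>\<close>, which a nonnegative sequence cannot sustain.
\<close>

lemma tendsto_zero_if_decrement:
  fixes d :: "nat \<Rightarrow> real" and \<eta> :: "real \<Rightarrow> real"
  assumes nonneg: "\<And>n. 0 \<le> d n"
    and step: "\<And>n. d (Suc n) \<le> d n - \<eta> (d n)"
    and mono: "mono_on {0..} \<eta>" and zero: "\<eta> 0 = 0" and pos: "\<And>t. t > 0 \<Longrightarrow> \<eta> t > 0"
  shows "d \<longlonglongrightarrow> 0"
proof (rule LIMSEQ_I)
  fix e :: real assume e: "e > 0"
  have eta_nonneg: "\<eta> (d n) \<ge> 0" for n
    using nonneg[of n] zero pos[of "d n"] by (cases "d n = 0") auto
  have "d (Suc n) \<le> d n" for n
    using step[of n] eta_nonneg[of n] by simp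
  then have anti: "antimono d"
    by (rule decseq_SucI)
  have "\<exists>N. d N < e"
  proof (rule ccontr)
    assume "\<not> ?thesis"
    then have ge: "e \<le> d n" for n
      by (meson not_le)
    have "\<eta> e \<le> \<eta> (d n)" for n
      using ge[of n] e by (intro mono_onD[OF mono]) auto
    then have dec: "d (Suc n) \<le> d n - \<eta> e" for n
      using step[of n] by (meson diff_left_mono order_trans)
    have "d n \<le> d 0 - real n * \<eta> e" for n
    proof (induction n)
      case (Suc n)
      then show ?case
        using dec[of n] by (simp add: algebra_simps)
    qed simp
    moreover obtain n :: nat where "d 0 < real n * \<eta> e"
      using ex_less_of_nat_mult[OF pos[OF e]] by blast
    ultimately show False
      using nonneg[of n] by (meson diff_less_0_iff_less leD order_trans)
  qed
  then obtain N where N: "d N < e"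
    by blast
  have "d n < e" if "n \<ge> N" for n
    using antimonoD[OF anti that] N by simp
  then show "\<exists>N. \<forall>n\<ge>N. norm (d n - 0) < e"
    using nonneg by auto
qed

section \<open>Contractions that compensate the coefficient\<close>

locale weak_contraction =
  fixes X :: "'a set" and q :: "'a \<Rightarrow> 'a \<Rightarrow> real" and s :: real
    and T :: "'a \<Rightarrow> 'a" and \<eta> :: "real \<Rightarrow> real"
  assumes space: "quasi_partial_b_metric_like X q s"
    and self_map: "T \<in> X \<rightarrow> X"
    and mono: "mono_on {0..} \<eta>"
    and eta_zero: "\<eta> 0 = 0"
    and eta_pos: "t > 0 \<Longrightarrow> \<eta> t > 0"
    and contraction: "x \<in> X \<Longrightarrow> y \<in> X \<Longrightarrow> s * q (T x) (T y) \<le> q x y - \<eta> (q x y)"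
begin

lemma carrier_nonempty: "X \<noteq> {}"
  and coeff_ge_1: "s \<ge> 1"
  and nonneg: "x \<in> X \<Longrightarrow> y \<in> X \<Longrightarrow> 0 \<le> q x y"
  and eq_if_zero: "x \<in> X \<Longrightarrow> y \<in> X \<Longrightarrow> q x y = 0 \<Longrightarrow> x = y"
  and self_le: "x \<in> X \<Longrightarrow> y \<in> X \<Longrightarrow> q x x \<le> q x y"
  and self_le': "x \<in> X \<Longrightarrow> y \<in> X \<Longrightarrow> q x x \<le> q y x"
  and strong_triangle:
    "x \<in> X \<Longrightarrow> y \<in> X \<Longrightarrow> z \<in> X \<Longrightarrow> q x y \<le> s * (q x z + q z y) - q z z"
  using space unfolding quasi_partial_b_metric_like_def by meson+

lemma triangle:
  assumes "x \<in> X" "y \<in> X" "z \<in> X"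
  shows "q x y \<le> s * q x z + s * q z y"
  using strong_triangle[OF assms] nonneg[of z z] assms by (simp add: distrib_left)

text \<open>
  Every estimate on \<open>q\<close> along an orbit thereby also holds with the two arguments exchanged.
\<close>

lemma dual: "weak_contraction X (\<lambda>x y. q y x) s T \<eta>"
proof
  show "quasi_partial_b_metric_like X (\<lambda>x y. q y x) s"
    unfolding quasi_partial_b_metric_like_def
  proof (intro conjI ballI)
    fix x y z assume xyz: "x \<in> X" "y \<in> X" "z \<in> X"
    have "q y x \<le> s * (q y z + q z x) - q z z"
      using strong_triangle xyz by blast
    then show "q y x \<le> s * (q z x + q y z) - q z z"
      by (simp only: add.commute)
  next
    fix x y assume "x \<in> X" "y \<in> X"
    then show "q y x = 0 \<longrightarrow> x = y"
      using eq_if_zero by blast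
  qed (use carrier_nonempty coeff_ge_1 nonneg self_le self_le' in \<open>simp_all\<close>)
qed (use self_map mono eta_zero eta_pos contraction in blast)+

lemma eta_nonneg: "t \<ge> 0 \<Longrightarrow> 0 \<le> \<eta> t"
  using eta_zero eta_pos[of t] by (cases "t = 0") auto

lemma image_decrement:
  assumes "x \<in> X" "y \<in> X"
  shows "q (T x) (T y) \<le> q x y - \<eta> (q x y)"
proof -
  have "T x \<in> X" "T y \<in> X"
    using self_map assms by auto
  then have "q (T x) (T y) \<le> s * q (T x) (T y)"
    using mult_right_mono[OF coeff_ge_1 nonneg[of "T x" "T y"]] by simp
  then show ?thesis
    using contraction[OF assms] by linarith
qed

lemma image_le: "x \<in> X \<Longrightarrow> y \<in> X \<Longrightarrow> q (T x) (T y) \<le> q x y"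
  using image_decrement[of x y] eta_nonneg[OF nonneg, of x y] by linarith

section \<open>Orbits are 0-Cauchy\<close>

lemma orbit_in: "x \<in> X \<Longrightarrow> (T ^^ n) x \<in> X"
  using self_map by (induction n) auto

lemma orbit_steps_tendsto_zero:
  assumes "x \<in> X"
  shows "(\<lambda>n. q ((T ^^ n) x) ((T ^^ Suc n) x)) \<longlonglongrightarrow> 0"
proof (rule tendsto_zero_if_decrement[OF _ _ mono eta_zero eta_pos])
  show "0 \<le> q ((T ^^ n) x) ((T ^^ Suc n) x)" for n
    using nonneg orbit_in[OF assms] by blast
  show "q ((T ^^ Suc n) x) ((T ^^ Suc (Suc n)) x)
      \<le> q ((T ^^ n) x) ((T ^^ Suc n) x) - \<eta> (q ((T ^^ n) x) ((T ^^ Suc n) x))" for n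
    using image_decrement[OF orbit_in[OF assms, of n] orbit_in[OF assms, of "Suc n"]] by simp
qed

text \<open>
  If \<open>q x y \<le> \<epsilon>/2\<close>, there is room for a step of size \<open>\<epsilon>/2\<close>; otherwise the contraction gains at
  least \<open>\<eta> (\<epsilon>/2)\<close>, which absorbs the step.
\<close>

lemma ball_invariant:
  assumes "x \<in> X" "y \<in> X" "\<epsilon> > 0" and close: "q x y \<le> \<epsilon>"
    and "s * q x (T x) \<le> \<epsilon> / 2" and "s * q x (T x) \<le> \<eta> (\<epsilon> / 2)"
  shows "q x (T y) \<le> \<epsilon>"
proof -
  have "T x \<in> X" "T y \<in> X"
    using self_map assms by auto
  then have "q x (T y) \<le> s * q x (T x) + s * q (T x) (T y)"
    using triangle assms by blast
  also have "\<dots> \<le> s * q x (T x) + (q x y - \<eta> (q x y))"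
    using contraction assms by simp
  also have "\<dots> \<le> \<epsilon>"
  proof (cases "q x y \<le> \<epsilon> / 2")
    case True
    then show ?thesis
      using eta_nonneg[OF nonneg, of x y] assms by linarith
  next
    case False
    then have "\<eta> (\<epsilon> / 2) \<le> \<eta> (q x y)"
      using \<open>\<epsilon> > 0\<close> by (intro mono_onD[OF mono]) auto
    then show ?thesis
      using assms by linarith
  qed
  finally show ?thesis .
qed

lemma orbit_stays_close:
  assumes x: "x \<in> X" and "\<epsilon> > 0"
  shows "\<exists>N. \<forall>n\<ge>N. \<forall>m\<ge>n. q ((T ^^ n) x) ((T ^^ m) x) \<le> \<epsilon>"
proof -
  let ?d = "\<lambda>n. q ((T ^^ n) x) ((T ^^ Suc n) x)"
  define \<delta> where "\<delta> = min (\<epsilon> / 2) (\<eta> (\<epsilon> / 2))"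
  have "\<delta> > 0"
    using \<open>\<epsilon> > 0\<close> eta_pos by (simp add: \<delta>_def)
  moreover have "(\<lambda>n. s * ?d n) \<longlonglongrightarrow> 0"
    using tendsto_mult_right_zero[OF orbit_steps_tendsto_zero[OF x]] .
  ultimately have "\<forall>\<^sub>F n in sequentially. s * ?d n < \<delta>"
    by (rule order_tendstoD(2)[rotated])
  then obtain N where N: "\<And>n. n \<ge> N \<Longrightarrow> s * ?d n < \<delta>"
    unfolding eventually_sequentially by blast
  have "q ((T ^^ n) x) ((T ^^ m) x) \<le> \<epsilon>" if "n \<ge> N" "m \<ge> n" for n m
    using \<open>m \<ge> n\<close>
  proof (induction m rule: dec_induct)
    case base
    have "q ((T ^^ n) x) ((T ^^ n) x) \<le> ?d n"
      using self_le orbit_in[OF x] by blast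
    also have "\<dots> \<le> s * ?d n"
      using mult_right_mono[OF coeff_ge_1 nonneg[OF orbit_in[OF x, of n] orbit_in[OF x, of "Suc n"]]]
      by simp
    also have "\<dots> \<le> \<epsilon>"
      using N[OF \<open>n \<ge> N\<close>] \<open>\<epsilon> > 0\<close> by (simp add: \<delta>_def)
    finally show ?case .
  next
    case (step m)
    have "q ((T ^^ n) x) (T ((T ^^ m) x)) \<le> \<epsilon>"
      using N[OF \<open>n \<ge> N\<close>] step.IH \<open>\<epsilon> > 0\<close> orbit_in[OF x]
      by (intro ball_invariant) (auto simp: \<delta>_def)
    then show ?case
      by simp
  qed
  then show ?thesis
    by blast
qed

lemma orbit_small:
  assumes x: "x \<in> X" and "\<epsilon> > 0"
  shows "\<exists>N. \<forall>n\<ge>N. \<forall>m\<ge>N. q ((T ^^ n) x) ((T ^^ m) x) \<le> \<epsilon>"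
proof -
  obtain N1 where N1: "\<And>n m. n \<ge> N1 \<Longrightarrow> m \<ge> n \<Longrightarrow> q ((T ^^ n) x) ((T ^^ m) x) \<le> \<epsilon>"
    using orbit_stays_close[OF assms] by blast
  obtain N2 where N2: "\<And>n m. n \<ge> N2 \<Longrightarrow> m \<ge> n \<Longrightarrow> q ((T ^^ m) x) ((T ^^ n) x) \<le> \<epsilon>"
    using weak_contraction.orbit_stays_close[OF dual assms] by blast
  have "q ((T ^^ n) x) ((T ^^ m) x) \<le> \<epsilon>" if "n \<ge> max N1 N2" "m \<ge> max N1 N2" for n m
    using that N1[of n m] N2[of m n] by (cases "n \<le> m") auto
  then show ?thesis
    by blast
qed

lemma orbit_double_limit:
  assumes x: "x \<in> X"
  shows "((\<lambda>(n, m). q ((T ^^ n) x) ((T ^^ m) x)) \<longlongrightarrow> 0) (sequentially \<times>\<^sub>F sequentially)"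
proof (rule tendstoI)
  fix e :: real assume "e > 0"
  then obtain N where N: "\<And>n m. n \<ge> N \<Longrightarrow> m \<ge> N \<Longrightarrow> q ((T ^^ n) x) ((T ^^ m) x) \<le> e / 2"
    using orbit_small[OF x, of "e / 2"] by auto
  have "\<forall>\<^sub>F p in sequentially \<times>\<^sub>F sequentially. N \<le> fst p \<and> N \<le> snd p"
    unfolding eventually_prod_sequentially by auto
  then show "\<forall>\<^sub>F p in sequentially \<times>\<^sub>F sequentially.
      dist (case p of (n, m) \<Rightarrow> q ((T ^^ n) x) ((T ^^ m) x)) 0 < e"
  proof (rule eventually_mono)
    fix p :: "nat \<times> nat" assume "N \<le> fst p \<and> N \<le> snd p"
    then show "dist (case p of (n, m) \<Rightarrow> q ((T ^^ n) x) ((T ^^ m) x)) 0 < e"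
      using N[of "fst p" "snd p"] nonneg[OF orbit_in[OF x] orbit_in[OF x], of "fst p" "snd p"]
        \<open>e > 0\<close>
      by (simp add: case_prod_beta)
  qed
qed

lemma orbit_zero_Cauchy: "x \<in> X \<Longrightarrow> zero_Cauchy q (\<lambda>n. (T ^^ n) x)"
  unfolding zero_Cauchy_def
  using orbit_double_limit weak_contraction.orbit_double_limit[OF dual] by blast

section \<open>Existence and uniqueness of the fixed point\<close>

text \<open>
  Convergence is needed on both sides: going from \<open>l\<close> to \<open>T l\<close> through \<open>x\<^sub>n\<^sub>+\<^sub>1\<close> involves
  \<open>q l (x\<^sub>n\<^sub>+\<^sub>1)\<close> on the way out and \<open>q (T x\<^sub>n) (T l) \<le> q (x\<^sub>n) l\<close> on the way back.
\<close>

lemma orbit_limit_fixed: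
  assumes x: "x \<in> X" and l: "l \<in> X"
    and to: "(\<lambda>n. q ((T ^^ n) x) l) \<longlonglongrightarrow> 0" and "from": "(\<lambda>n. q l ((T ^^ n) x)) \<longlonglongrightarrow> 0"
  shows "T l = l"
proof -
  have Tl: "T l \<in> X"
    using self_map l by auto
  have bound: "q l (T l) \<le> s * q l ((T ^^ Suc n) x) + s * q ((T ^^ n) x) l" for n
  proof -
    have "q l (T l) \<le> s * q l ((T ^^ Suc n) x) + s * q ((T ^^ Suc n) x) (T l)"
      using triangle[OF l Tl orbit_in[OF x]] .
    moreover have "s * q ((T ^^ Suc n) x) (T l) \<le> s * q ((T ^^ n) x) l"
      using image_le[OF orbit_in[OF x, of n] l] coeff_ge_1 by simp
    ultimately show ?thesis
      by linarith
  qed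
  have "(\<lambda>n. s * q l ((T ^^ Suc n) x) + s * q ((T ^^ n) x) l) \<longlonglongrightarrow> s * 0 + s * 0"
    using to LIMSEQ_Suc[OF "from"] by (intro tendsto_intros)
  then have "q l (T l) \<le> s * 0 + s * 0"
    by (rule LIMSEQ_le_const) (use bound in blast)
  then show ?thesis
    using nonneg[OF l Tl] eq_if_zero[OF l Tl] by simp
qed

lemma fixed_points_equal:
  assumes "x \<in> X" "y \<in> X" "T x = x" "T y = y"
  shows "x = y"
proof -
  have "\<eta> (q x y) \<le> 0"
    using image_decrement[of x y] assms by simp
  then have "q x y = 0"
    using eta_pos[of "q x y"] nonneg[of x y] assms by linarith
  then show ?thesis
    using eq_if_zero assms by blast
qed

lemma unique_fixed_point:
  assumes complete: "zero_complete X q"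
  shows "\<exists>!x. x \<in> X \<and> T x = x"
proof -
  obtain x where x: "x \<in> X"
    using carrier_nonempty by blast
  have "range (\<lambda>n. (T ^^ n) x) \<subseteq> X"
    using orbit_in[OF x] by blast
  then obtain l where l: "l \<in> X" and lim: "(\<lambda>n. q ((T ^^ n) x) l) \<longlonglongrightarrow> q l l"
      "(\<lambda>n. q l ((T ^^ n) x)) \<longlonglongrightarrow> q l l" "q l l = 0"
    using complete orbit_zero_Cauchy[OF x] unfolding zero_complete_def by blast
  have "T l = l"
    using orbit_limit_fixed[OF x l] lim by simp
  then show ?thesis
    using l fixed_points_equal by blast
qed

end

section \<open>Reduction of the \<open>\<phi>\<close>-\<open>\<psi>\<close> condition\<close>

theorem theorem4p9:
  fixes X :: "'a set" and q :: "'a \<Rightarrow> 'a \<Rightarrow> real" and s :: real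
    and T :: "'a \<Rightarrow> 'a" and \<phi> \<psi> :: "real \<Rightarrow> real"
  assumes "quasi_partial_b_metric_like X q s"
    and "zero_complete X q"
    and "T \<in> X \<rightarrow> X"
    and "\<phi> \<in> {0..} \<rightarrow> {0..}" and "\<psi> \<in> {0..} \<rightarrow> {0..}"
    and "continuous_on {0..} \<phi>" and "continuous_on {0..} \<psi>"
    and "mono_on {0..} \<phi>" and "mono_on {0..} \<psi>"
    and "\<forall>t\<ge>0. \<phi> t = 0 \<longleftrightarrow> t = 0"
    and "\<forall>t\<ge>0. \<psi> t = 0 \<longleftrightarrow> t = 0"
    and "linear_on_nonneg \<phi>"
    and "\<forall>t>0. \<phi> (\<psi> t) \<le> \<psi> t"
    and "\<forall>x\<in>X. \<forall>y\<in>X. \<phi> (q (T x) (T y)) \<le> \<phi> (q x y) / s - \<psi> (q x y)"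
  shows "\<exists>!x. x \<in> X \<and> T x = x"
proof -
  have s: "s \<ge> 1"
    using assms(1) unfolding quasi_partial_b_metric_like_def by meson
  have q_nonneg: "0 \<le> q x y" if "x \<in> X" "y \<in> X" for x y
    using assms(1) that unfolding quasi_partial_b_metric_like_def by meson
  have "\<phi> 1 \<ge> 0" "\<phi> 1 \<noteq> 0"
    using assms(4,10) by auto
  then have k: "\<phi> 1 > 0"
    by simp
  interpret weak_contraction X q s T "\<lambda>t. s * \<psi> t / \<phi> 1"
  proof
    show "mono_on {0..} (\<lambda>t. s * \<psi> t / \<phi> 1)"
      using assms(9) s k by (auto simp: mono_on_def intro!: divide_right_mono mult_left_mono)
    show "s * \<psi> 0 / \<phi> 1 = 0"
      using assms(11) by simp
  next
    fix t :: real assume "t > 0"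
    then have "\<psi> t \<ge> 0" "\<psi> t \<noteq> 0"
      using assms(5,11) by auto
    then show "s * \<psi> t / \<phi> 1 > 0"
      using s k by simp
  next
    fix x y assume xy: "x \<in> X" "y \<in> X"
    then have Txy: "T x \<in> X" "T y \<in> X"
      using assms(3) by auto
    have "\<phi> (q (T x) (T y)) \<le> \<phi> (q x y) / s - \<psi> (q x y)"
      using assms(14) xy by blast
    then have "\<phi> 1 * q (T x) (T y) \<le> \<phi> 1 * q x y / s - \<psi> (q x y)"
      unfolding linear_on_nonneg_eq_scale[OF assms(12) q_nonneg[OF xy]]
        linear_on_nonneg_eq_scale[OF assms(12) q_nonneg[OF Txy]] .
    then show "s * q (T x) (T y) \<le> q x y - s * \<psi> (q x y) / \<phi> 1"
      using s k by (simp add: field_simps)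
  qed (use assms(1,3) in auto)
  show ?thesis
    using unique_fixed_point[OF assms(2)] .
qed

end
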